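(* Suppose $G=G^*\cup K_1$, where $G^*$ is a graph (not necessarily connected) with $m$ edges, $k$ vertices and minimum degree $\delta(G^* )>0$. Then for every $n\ge |G|$, $$\mathrm{ex}(n,G^* )\;\le\;\mathrm{st}(n,G)\;\le\;\mathrm{ex}(n,G^* )+\min\{\delta(G^* )\,n,\; nm/k\}.$$
   Context: Graphs are finite and simple; $|G|$ is the number of vertices of $G$; $\cup$ denotes vertex-disjoint union. $\mathrm{ex}(n,G)$ is the maximum number of edges of a graph on $n$ vertices containing no (not necessarily induced) copy of $G$. For a non-complete graph $G$ on $r$ vertices and $n\ge r$, $\mathrm{st}(n,G)$ is the largest $M$ for which there is a graph $H$ with $n$ vertices and $M$ edges such that no subgraph $F\subseteq H$ on exactly $r$ vertices contains $G$ as a proper subgraph. *)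

theory Defs
  imports Complex_Main
begin

type_synonym 'a graph = "'a set \<times> 'a set set"

abbreviation verts :: "'a graph \<Rightarrow> 'a set" where
  "verts G \<equiv> fst G"

abbreviation edges :: "'a graph \<Rightarrow> 'a set set" where
  "edges G \<equiv> snd G"

definition is_graph :: "'a graph \<Rightarrow> bool" where
  "is_graph G \<longleftrightarrow> finite (verts G) \<and> (\<forall>e \<in> edges G. e \<subseteq> verts G \<and> card e = 2)"

definition subgraph :: "'a graph \<Rightarrow> 'a graph \<Rightarrow> bool" where
  "subgraph F H \<longleftrightarrow>
     is_graph F \<and> is_graph H \<and> verts F \<subseteq> verts H \<and> edges F \<subseteq> edges H"

definition graph_iso :: "'a graph \<Rightarrow> 'b graph \<Rightarrow> bool" where
  "graph_iso G H \<longleftrightarrow>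
     (\<exists>f. bij_betw f (verts G) (verts H) \<and> edges H = (\<lambda>e. f ` e) ` edges G)"

definition contains :: "'a graph \<Rightarrow> 'b graph \<Rightarrow> bool" where
  "contains H G \<longleftrightarrow> (\<exists>F. subgraph F H \<and> graph_iso G F)"

definition contains_properly :: "'a graph \<Rightarrow> 'b graph \<Rightarrow> bool" where
  "contains_properly H G \<longleftrightarrow> (\<exists>F. subgraph F H \<and> F \<noteq> H \<and> graph_iso G F)"

definition graph_union :: "'a graph \<Rightarrow> 'a graph \<Rightarrow> 'a graph" where
  "graph_union G H = (verts G \<union> verts H, edges G \<union> edges H)"

definition complete_on :: "'a set \<Rightarrow> 'a graph" where
  "complete_on S = (S, {e. e \<subseteq> S \<and> card e = 2})"

definition degree :: "'a graph \<Rightarrow> 'a \<Rightarrow> nat" where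
  "degree G v = card {e \<in> edges G. v \<in> e}"

text \<open>The graph without vertices is given minimum degree \<open>0\<close>, so a graph of positive
  minimum degree has a vertex (and hence an edge).\<close>

definition min_degree :: "'a graph \<Rightarrow> nat" where
  "min_degree G = (if verts G = {} then 0 else Min (degree G ` verts G))"

text \<open>In both extremal functions the host graph \<open>H\<close> has its vertices in \<^typ>\<open>nat\<close>; every finite
  graph is isomorphic to such a graph. The sets of edge numbers are finite, being bounded by
  \<open>n choose 2\<close>. The set in \<open>ex\<close> is nonempty if \<open>G\<close> has an edge (take \<open>H\<close> edgeless); if \<open>G\<close> is
  edgeless with at most \<open>n\<close> vertices, it is empty and \<open>ex n G\<close> is an unspecified number. The set
  in \<open>st\<close> is nonempty for every graph \<open>G\<close>; the notion is meant for non-complete \<open>G\<close> with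
  at most \<open>n\<close> vertices.\<close>

definition ex :: "nat \<Rightarrow> 'a graph \<Rightarrow> nat" where
  "ex n G = Max {card (edges H) | H :: nat graph.
     is_graph H \<and> card (verts H) = n \<and> \<not> contains H G}"

definition st :: "nat \<Rightarrow> 'a graph \<Rightarrow> nat" where
  "st n G = Max {card (edges H) | H :: nat graph.
     is_graph H \<and> card (verts H) = n \<and>
     \<not> (\<exists>F. subgraph F H \<and> card (verts F) = card (verts G) \<and> contains_properly F G)}"

end

theory Submission
  imports Defs
begin

text \<open>The lower bound holds because a graph without a copy of \<open>Gs\<close> has no copy of
  \<open>G = Gs \<union> K\<^sub>1\<close> either.

  For the upper bound, let \<open>H\<close> be a graph on \<open>n > k\<close> vertices in which no subgraph on \<open>k + 1\<close>
  vertices contains \<open>G\<close> properly. A copy \<open>C\<close> of \<open>Gs\<close> in \<open>H\<close> together with any vertex outside it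
  is a copy of \<open>G\<close>. Hence every edge of \<open>H\<close> that meets \<open>C\<close> belongs to \<open>C\<close>: otherwise it could be
  added to such a copy of \<open>G\<close>, the extra vertex being its endpoint outside \<open>C\<close> if there is one
  (lemma \<open>edges_meeting_copy\<close>). Two ways to destroy the copy follow. Isolating a vertex of minimum
  degree of \<open>C\<close> costs \<open>\<delta>\<close> edges and makes one vertex isolated that was not isolated before;
  isolating all vertices of \<open>C\<close> costs \<open>m\<close> edges and does so with \<open>k\<close> vertices. The property
  of \<open>H\<close> passes to spanning subgraphs, so the step can be repeated until no copy of \<open>Gs\<close> is left.
  Since at most \<open>n\<close> vertices can become isolated, at most \<open>\<delta> n\<close>, respectively
  \<open>n m / k\<close>, edges are deleted (lemma \<open>edges_le_by_peeling\<close>).\<close>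

section \<open>Strongly free graphs\<close>

text \<open>The graphs admitted in the definition of \<^const>\<open>st\<close>: no subgraph on \<open>|G|\<close> vertices
  contains \<open>G\<close> properly.\<close>

definition strongly_free :: "'b graph \<Rightarrow> 'a graph \<Rightarrow> bool" where
  "strongly_free H G \<longleftrightarrow>
     \<not> (\<exists>F. subgraph F H \<and> card (verts F) = card (verts G) \<and> contains_properly F G)"

lemma edges_complete_on_singleton [simp]: "edges (complete_on {v}) = {}"
proof -
  have "\<not> (e \<subseteq> {v} \<and> card e = 2)" for e
    using card_mono[of "{v}" e] by auto
  then show ?thesis
    by (auto simp: complete_on_def)
qed

lemma verts_complete_on [simp]: "verts (complete_on S) = S"
  by (simp add: complete_on_def)

lemma subgraph_trans: "subgraph F H \<Longrightarrow> subgraph H K \<Longrightarrow> subgraph F K"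
  by (auto simp: subgraph_def)

lemma is_graph_finite_edges: "is_graph H \<Longrightarrow> finite (edges H)"
  by (rule finite_subset[of _ "Pow (verts H)"]) (auto simp: is_graph_def)

lemma strongly_free_subgraph: "strongly_free H G \<Longrightarrow> subgraph K H \<Longrightarrow> strongly_free K G"
  by (meson strongly_free_def subgraph_trans)

lemma contains_isolated_vertexD:
  assumes "is_graph Gs" "contains H (graph_union Gs (complete_on {v}))"
  shows "contains H Gs"
proof -
  obtain F f where F: "subgraph F H" and f: "bij_betw f (insert v (verts Gs)) (verts F)"
    and e: "edges F = (\<lambda>e. f ` e) ` edges Gs"
    using assms(2) by (auto simp: contains_def graph_iso_def graph_union_def)
  let ?C = "(f ` verts Gs, edges F)"
  have "subgraph ?C H"
    using F f assms(1) unfolding subgraph_def is_graph_def e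
    by (auto simp: bij_betw_def)
  moreover have "graph_iso Gs ?C"
    unfolding graph_iso_def using f e by (auto simp: bij_betw_def intro: inj_on_subset)
  ultimately show ?thesis
    by (auto simp: contains_def)
qed

lemma not_contains_imp_strongly_free:
  assumes "is_graph Gs" "\<not> contains H Gs"
  shows "strongly_free H (graph_union Gs (complete_on {v}))"
  using contains_isolated_vertexD[OF assms(1), of H v] assms(2)
  unfolding strongly_free_def contains_properly_def contains_def by (meson subgraph_trans)

section \<open>Attained extremal numbers\<close>

lemma finite_edge_counts: "finite {card (edges H) | H :: nat graph. is_graph H \<and> card (verts H) = n \<and> P H}"
proof (rule finite_subset)
  show "{card (edges H) | H :: nat graph. is_graph H \<and> card (verts H) = n \<and> P H} \<subseteq> {..2 ^ n}"
  proof clarsimp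
    fix V :: "nat set" and E
    assume "is_graph (V, E)"
    then have "E \<subseteq> Pow V" "finite V"
      by (auto simp: is_graph_def)
    then show "card E \<le> 2 ^ card V"
      using card_mono[of "Pow V" E] by (simp add: card_Pow)
  qed
qed simp

lemma card_edges_le_ex:
  fixes H :: "nat graph"
  assumes "is_graph H" "card (verts H) = n" "\<not> contains H G"
  shows "card (edges H) \<le> ex n G"
  unfolding ex_def by (rule Max_ge[OF finite_edge_counts]) (use assms in blast)

lemma card_edges_le_st:
  fixes H :: "nat graph"
  assumes "is_graph H" "card (verts H) = n" "strongly_free H G"
  shows "card (edges H) \<le> st n G"
  unfolding st_def
  by (rule Max_ge[OF finite_edge_counts]) (use assms in \<open>unfold strongly_free_def, blast\<close>)

lemma ex_attained:
  assumes "edges G \<noteq> {}"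
  obtains H :: "nat graph" where "is_graph H" "card (verts H) = n" "\<not> contains H G"
    "card (edges H) = ex n G"
proof -
  let ?S = "{card (edges H) | H :: nat graph. is_graph H \<and> card (verts H) = n \<and> \<not> contains H G}"
  let ?H = "({..<n}, {}) :: nat graph"
  have "is_graph ?H \<and> card (verts ?H) = n \<and> \<not> contains ?H G"
    using assms by (auto simp: is_graph_def contains_def subgraph_def graph_iso_def)
  then have "?S \<noteq> {}"
    by blast
  then have "ex n G \<in> ?S"
    unfolding ex_def by (rule Max_in[OF finite_edge_counts])
  then show ?thesis
    using that by auto
qed

lemma st_attained:
  assumes "strongly_free H0 G" "is_graph (H0 :: nat graph)" "card (verts H0) = n"
  obtains H :: "nat graph" where "is_graph H" "card (verts H) = n" "strongly_free H G"
    "card (edges H) = st n G"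
proof -
  let ?S = "{card (edges H) | H :: nat graph. is_graph H \<and> card (verts H) = n \<and> strongly_free H G}"
  have "?S \<noteq> {}"
    using assms by blast
  then have "Max ?S \<in> ?S"
    by (rule Max_in[OF finite_edge_counts])
  moreover have "st n G = Max ?S"
    by (simp add: st_def strongly_free_def)
  ultimately show ?thesis
    using that by auto
qed

section \<open>Copies in strongly free graphs\<close>

text \<open>The key step: in a graph that is strongly free for \<open>Gs \<union> K\<^sub>1\<close>, a copy of \<open>Gs\<close> (the graph \<open>C\<close>)
  accounts for all edges at its vertices. A vertex of \<open>H\<close> outside \<open>C\<close> is needed, hence the bound
  on the number of vertices.\<close>

lemma edges_meeting_copy:
  assumes Gs: "is_graph Gs" "v \<notin> verts Gs"
    and H: "is_graph H" "strongly_free H (graph_union Gs (complete_on {v}))"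
    and large: "card (verts Gs) < card (verts H)"
    and C: "subgraph C H" "graph_iso Gs C"
    and e: "e \<in> edges H" "e \<inter> verts C \<noteq> {}"
  shows "e \<in> edges C"
proof (rule ccontr)
  assume "e \<notin> edges C"
  obtain f where f: "bij_betw f (verts Gs) (verts C)" "edges C = (\<lambda>e. f ` e) ` edges Gs"
    using C(2) by (auto simp: graph_iso_def)
  have card_C: "card (verts C) = card (verts Gs)"
    using f(1) by (simp add: bij_betw_same_card)
  have fin: "finite (verts C)" "finite (verts Gs)"
    using C(1) Gs(1) by (auto simp: subgraph_def is_graph_def)
  have "e \<subseteq> verts H" "card e = 2"
    using e(1) H(1) by (auto simp: is_graph_def)
  obtain w where w: "w \<in> verts H" "w \<notin> verts C" "e \<subseteq> insert w (verts C)"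
  proof (cases "e \<subseteq> verts C")
    case True
    have "\<not> verts H \<subseteq> verts C"
      using large card_C card_mono[OF fin(1)] by (metis leD)
    then show ?thesis
      using that True by blast
  next
    case False
    obtain a b where "e = {a, b}"
      using \<open>card e = 2\<close> by (auto simp: card_2_iff)
    then show ?thesis
      using that False e(2) \<open>e \<subseteq> verts H\<close> by auto
  qed
  \<comment> \<open>\<open>?K\<close> is a copy of \<open>Gs \<union> K\<^sub>1\<close>, and \<open>?F\<close> has the same vertices and the additional edge \<open>e\<close>.\<close>
  let ?K = "(insert w (verts C), edges C)"
  let ?F = "(insert w (verts C), insert e (edges C))"
  have sub: "subgraph ?F H" "subgraph ?K ?F"
    using C(1) w e(1) \<open>card e = 2\<close> by (auto simp: subgraph_def is_graph_def)
  have "?K \<noteq> ?F"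
    using \<open>e \<notin> edges C\<close> by auto
  moreover have "graph_iso (graph_union Gs (complete_on {v})) ?K"
  proof -
    let ?g = "f(v := w)"
    have "?g ` d = f ` d" if "d \<in> edges Gs" for d
      using that Gs by (auto simp: is_graph_def fun_upd_def image_iff)
    then have "edges ?K = (\<lambda>d. ?g ` d) ` edges Gs"
      using f(2) by (simp cong: image_cong)
    moreover have "bij_betw ?g (insert v (verts Gs)) (insert w (verts C))"
      using f(1) Gs(2) w(2) by (auto simp: bij_betw_def inj_on_def)
    ultimately show ?thesis
      unfolding graph_iso_def graph_union_def by auto
  qed
  ultimately have "contains_properly ?F (graph_union Gs (complete_on {v}))"
    unfolding contains_properly_def using sub(2) by (intro exI[of _ ?K]) simp
  moreover have "subgraph ?F H" "card (verts ?F) = card (verts (graph_union Gs (complete_on {v})))"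
    using sub(1) fin w(2) Gs(2) card_C by (simp_all add: graph_union_def)
  ultimately show False
    using H(2) unfolding strongly_free_def by metis
qed

lemma degree_iso:
  assumes "is_graph G" "bij_betw f (verts G) (verts C)" "edges C = (\<lambda>e. f ` e) ` edges G"
    and "x \<in> verts G"
  shows "degree C (f x) = degree G x"
proof -
  have inj: "inj_on f (verts G)"
    using assms(2) by (simp add: bij_betw_def)
  have sub: "e \<subseteq> verts G" if "e \<in> edges G" for e
    using that assms(1) by (auto simp: is_graph_def)
  have "f x \<in> f ` e \<longleftrightarrow> x \<in> e" if "e \<in> edges G" for e
    using inj_on_image_mem_iff[OF inj assms(4) sub[OF that]] .
  then have "{e \<in> edges C. f x \<in> e} = (\<lambda>e. f ` e) ` {e \<in> edges G. x \<in> e}"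
    unfolding assms(3) by blast
  moreover have "inj_on (\<lambda>e. f ` e) {e \<in> edges G. x \<in> e}"
    by (rule inj_onI) (use inj sub in \<open>auto simp: inj_on_image_eq_iff\<close>)
  ultimately show ?thesis
    by (simp add: degree_def card_image)
qed

lemma min_degree_attained:
  assumes "is_graph G" "verts G \<noteq> {}"
  obtains x where "x \<in> verts G" "degree G x = min_degree G"
proof -
  have "Min (degree G ` verts G) \<in> degree G ` verts G"
    using assms by (intro Min_in) (auto simp: is_graph_def)
  then obtain x where "x \<in> verts G" "degree G x = Min (degree G ` verts G)"
    by (metis imageE)
  then show ?thesis
    using assms(2) that by (simp add: min_degree_def)
qed

lemma min_degree_le: "is_graph G \<Longrightarrow> x \<in> verts G \<Longrightarrow> min_degree G \<le> degree G x"
  by (auto simp: min_degree_def is_graph_def)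

section \<open>Destroying all copies\<close>

text \<open>If every strongly free graph that contains a copy of \<open>Gs\<close> has a nonempty set \<open>X\<close> of
  non-isolated vertices that can be isolated at a cost of at most \<open>c\<close> edges per vertex, then
  repetition makes a strongly free graph \<open>Gs\<close>-free at a cost of at most \<open>c\<close> edges per non-isolated
  vertex. The non-isolated vertices of \<open>H\<close> are those in \<open>\<Union>(edges H)\<close>.\<close>

lemma edges_le_by_peeling:
  fixes H :: "nat graph" and c :: real
  assumes step: "\<And>H :: nat graph. is_graph H \<Longrightarrow> card (verts H) = n \<Longrightarrow> strongly_free H G \<Longrightarrow>
      contains H Gs \<Longrightarrow> \<exists>X \<subseteq> \<Union>(edges H). X \<noteq> {} \<and>
        real (card {e \<in> edges H. e \<inter> X \<noteq> {}}) \<le> c * real (card X)"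
    and "c \<ge> 0" "is_graph H" "card (verts H) = n" "strongly_free H G"
  shows "real (card (edges H)) \<le> real (ex n Gs) + c * real (card (\<Union>(edges H)))"
  using assms(3-5)
proof (induction "card (edges H)" arbitrary: H rule: less_induct)
  case less
  have finE: "finite (edges H)"
    using less.prems(1) by (rule is_graph_finite_edges)
  show ?case
  proof (cases "contains H Gs")
    case False
    then have "card (edges H) \<le> ex n Gs"
      using card_edges_le_ex less.prems by blast
    then show ?thesis
      using \<open>c \<ge> 0\<close> by (simp add: add_increasing2)
  next
    case True
    then obtain X where X: "X \<subseteq> \<Union>(edges H)" "X \<noteq> {}"
      and cost: "real (card {e \<in> edges H. e \<inter> X \<noteq> {}}) \<le> c * real (card X)"
      using step less.prems by blast
    define D where "D = {e \<in> edges H. e \<inter> X \<noteq> {}}"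
    define K where "K = (verts H, edges H - D)"
    have "D \<subseteq> edges H" "D \<noteq> {}"
      using X by (auto simp: D_def)
    have card_D: "card (edges H) = card (edges K) + card D"
      using card_Diff_subset[of D "edges H"] card_mono[OF finE \<open>D \<subseteq> edges H\<close>]
        finite_subset[OF \<open>D \<subseteq> edges H\<close> finE] \<open>D \<subseteq> edges H\<close>
      by (simp add: K_def)
    have "card D > 0"
      using \<open>D \<noteq> {}\<close> finite_subset[OF \<open>D \<subseteq> edges H\<close> finE] by (simp add: card_gt_0_iff)
    have "subgraph K H"
      using less.prems(1) by (auto simp: K_def subgraph_def is_graph_def)
    then have "real (card (edges K)) \<le> real (ex n Gs) + c * real (card (\<Union>(edges K)))"
      using less.hyps[of K] less.prems card_D \<open>card D > 0\<close>
        strongly_free_subgraph[OF less.prems(3)]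
      by (simp add: subgraph_def K_def)
    moreover have "card (\<Union>(edges K)) + card X \<le> card (\<Union>(edges H))"
    proof -
      have fin: "finite (\<Union>(edges H))"
        by (rule finite_subset[of _ "verts H"]) (use less.prems(1) in \<open>auto simp: is_graph_def\<close>)
      have "\<Union>(edges K) \<inter> X = {}" "\<Union>(edges K) \<union> X \<subseteq> \<Union>(edges H)"
        using X(1) by (auto simp: K_def D_def)
      then show ?thesis
        using card_Un_disjoint[of "\<Union>(edges K)" X] card_mono[OF fin, of "\<Union>(edges K) \<union> X"]
          finite_subset[OF _ fin] by simp
    qed
    then have "c * real (card (\<Union>(edges K))) + c * real (card X) \<le> c * real (card (\<Union>(edges H)))"
      using \<open>c \<ge> 0\<close> by (metis mult_left_mono distrib_left of_nat_add of_nat_le_iff)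
    ultimately show ?thesis
      using cost card_D by (simp add: D_def)
  qed
qed

section \<open>Bounds for the extremal numbers\<close>

theorem theorem10:
  fixes G Gs :: "'a graph" and v :: 'a and m k n :: nat
  assumes "is_graph Gs"
    and "card (edges Gs) = m"
    and "card (verts Gs) = k"
    and "min_degree Gs > 0"
    and "v \<notin> verts Gs"
    and "G = graph_union Gs (complete_on {v})"
    and "n \<ge> card (verts G)"
  shows "ex n Gs \<le> st n G \<and>
    real (st n G) \<le> real (ex n Gs) +
      min (real (min_degree Gs) * real n) (real n * real m / real k)"
proof -
  have ne: "verts Gs \<noteq> {}"
    using assms(4) by (auto simp: min_degree_def)
  have finV: "finite (verts Gs)"
    using assms(1) by (simp add: is_graph_def)
  then have "k > 0"
    using ne assms(3) by (auto simp: card_gt_0_iff)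
  have "k < n"
    using assms(3,5,6,7) finV by (simp add: graph_union_def)
  obtain x where x: "x \<in> verts Gs" "degree Gs x = min_degree Gs"
    using min_degree_attained[OF assms(1) ne] .
  have "edges Gs \<noteq> {}"
    using x assms(4) by (auto simp: degree_def)
  then obtain H0 :: "nat graph" where H0: "is_graph H0" "card (verts H0) = n"
    "\<not> contains H0 Gs" "card (edges H0) = ex n Gs"
    using ex_attained by metis
  have sf0: "strongly_free H0 G"
    unfolding assms(6) using not_contains_imp_strongly_free[OF assms(1) H0(3)] .
  have lower: "ex n Gs \<le> st n G"
    using card_edges_le_st[OF H0(1,2) sf0] H0(4) by simp

  obtain H :: "nat graph" where H: "is_graph H" "card (verts H) = n" "strongly_free H G"
    "card (edges H) = st n G"
    using st_attained[OF sf0 H0(1,2)] .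
  have nonisolated: "card (\<Union>(edges H)) \<le> n"
    using card_mono[of "verts H" "\<Union>(edges H)"] H(1,2) by (auto simp: is_graph_def)
  \<comment> \<open>Every copy \<open>C\<close> of \<open>Gs\<close> is a union of components; positive minimum degree excludes isolated
    vertices from it.\<close>
  have copy: "\<exists>f C. subgraph C K \<and> f ` verts Gs = verts C \<and> verts C \<subseteq> \<Union>(edges K) \<and>
      card (verts C) = k \<and> card (edges C) = m \<and> degree C (f x) = min_degree Gs \<and>
      (\<forall>e \<in> edges K. e \<inter> verts C \<noteq> {} \<longrightarrow> e \<in> edges C)"
    if K: "is_graph K" "card (verts K) = n" "strongly_free K G" "contains K Gs" for K :: "nat graph"
  proof -
    obtain C f where C: "subgraph C K" and f: "bij_betw f (verts Gs) (verts C)"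
      "edges C = (\<lambda>e. f ` e) ` edges Gs"
      using K(4) by (auto simp: contains_def graph_iso_def)
    have "graph_iso Gs C"
      using f by (auto simp: graph_iso_def)
    then have "\<forall>e \<in> edges K. e \<inter> verts C \<noteq> {} \<longrightarrow> e \<in> edges C"
      using edges_meeting_copy[OF assms(1,5) K(1) _ _ C] K(2,3) assms(3,6) \<open>k < n\<close> by auto
    moreover have "verts C \<subseteq> \<Union>(edges K)"
    proof
      fix y
      assume "y \<in> verts C"
      then obtain z where z: "z \<in> verts Gs" "y = f z"
        using f(1) by (auto simp: bij_betw_def)
      have "degree C y > 0"
        using degree_iso[OF assms(1) f z(1)] min_degree_le[OF assms(1) z(1)] assms(4) z(2) by simp
      then have "{e \<in> edges C. y \<in> e} \<noteq> {}"
        unfolding degree_def by (metis card.empty less_irrefl)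
      then show "y \<in> \<Union>(edges K)"
        using C by (auto simp: subgraph_def)
    qed
    moreover have "inj_on (\<lambda>e. f ` e) (edges Gs)"
      by (rule inj_onI) (use f(1) assms(1) in
        \<open>auto simp: bij_betw_def is_graph_def inj_on_image_eq_iff\<close>)
    then have "card (edges C) = m"
      using f(2) assms(2) by (simp add: card_image)
    moreover have "degree C (f x) = min_degree Gs"
      using degree_iso[OF assms(1) f x(1)] x(2) by simp
    ultimately show ?thesis
      using C f(1) assms(3) by (metis bij_betw_def bij_betw_same_card)
  qed

  \<comment> \<open>Isolate one vertex of minimum degree of each copy.\<close>
  have "real (st n G) \<le> real (ex n Gs) + real (min_degree Gs) * real (card (\<Union>(edges H)))"
    unfolding H(4)[symmetric]
  proof (rule edges_le_by_peeling[OF _ _ H(1-3)])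
    fix K :: "nat graph"
    assume K: "is_graph K" "card (verts K) = n" "strongly_free K G" "contains K Gs"
    obtain f C where C: "subgraph C K" "f ` verts Gs = verts C" "verts C \<subseteq> \<Union>(edges K)"
      "degree C (f x) = min_degree Gs" "\<forall>e \<in> edges K. e \<inter> verts C \<noteq> {} \<longrightarrow> e \<in> edges C"
      using copy[OF K] by metis
    have "f x \<in> verts C"
      using C(2) x(1) by blast
    then have "{e \<in> edges K. e \<inter> {f x} \<noteq> {}} = {e \<in> edges C. f x \<in> e}"
      using C(1,5) by (auto simp: subgraph_def)
    then have "card {e \<in> edges K. e \<inter> {f x} \<noteq> {}} = min_degree Gs"
      using C(4) by (simp add: degree_def)
    then show "\<exists>X \<subseteq> \<Union>(edges K). X \<noteq> {} \<and>
        real (card {e \<in> edges K. e \<inter> X \<noteq> {}}) \<le> real (min_degree Gs) * real (card X)"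
      using \<open>f x \<in> verts C\<close> C(3) by (intro exI[of _ "{f x}"]) auto
  qed simp
  moreover have "\<dots> \<le> real (ex n Gs) + real (min_degree Gs) * real n"
    using nonisolated by (simp add: mult_left_mono)
  \<comment> \<open>Isolate all vertices of each copy.\<close>
  moreover have "real (st n G) \<le> real (ex n Gs) + real m / real k * real (card (\<Union>(edges H)))"
    unfolding H(4)[symmetric]
  proof (rule edges_le_by_peeling[OF _ _ H(1-3)])
    fix K :: "nat graph"
    assume K: "is_graph K" "card (verts K) = n" "strongly_free K G" "contains K Gs"
    obtain C where C: "subgraph C K" "verts C \<subseteq> \<Union>(edges K)" "card (verts C) = k"
      "card (edges C) = m" "\<forall>e \<in> edges K. e \<inter> verts C \<noteq> {} \<longrightarrow> e \<in> edges C"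
      using copy[OF K] by metis
    have "{e \<in> edges K. e \<inter> verts C \<noteq> {}} \<subseteq> edges C" "finite (edges C)"
      using C(1,5) is_graph_finite_edges[of C] by (auto simp: subgraph_def)
    then have "card {e \<in> edges K. e \<inter> verts C \<noteq> {}} \<le> m"
      using C(4) card_mono by metis
    then show "\<exists>X \<subseteq> \<Union>(edges K). X \<noteq> {} \<and>
        real (card {e \<in> edges K. e \<inter> X \<noteq> {}}) \<le> real m / real k * real (card X)"
      using C(2,3) \<open>k > 0\<close> by (intro exI[of _ "verts C"]) auto
  qed simp
  moreover have "\<dots> \<le> real (ex n Gs) + real n * real m / real k"
    using mult_left_mono[of "real (card (\<Union>(edges H)))" "real n" "real m / real k"] nonisolated
    by (simp add: mult.commute)
  ultimately show ?thesis
    using lower by linarith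
qed

end
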